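(* Suppose there exists $k\in\{1,\dots,n_{\mathrm{spec}}\}$ such that $\ker(A^{(k)})=\{0\}$ and such that for all $i\in\{k,\dots,n_{\mathrm{spec}}\}$ there is a sensitivity function $s_{b_i}$ (with $b_i\in\{1,\dots,n_{\mathrm{bin}}\}$) with $\int_{I_j}s_{b_i}(E)\,\mathrm{d}E\neq 0$ for all $j\in\{1,\dots,n_{\mathrm{spec}}\}$ with $j\geq i$ and $\int_{I_j}s_{b_i}(E)\,\mathrm{d}E=0$ for all $j\in\{1,\dots,n_{\mathrm{spec}}\}$ with $j<i$. Then for every $y\in\operatorname{Im}(\Phi)$ there exists only one $z\in\mathbb{R}^{n_{\mathrm{mat}}}$ such that $\Phi(z)=y$.
   Context: Let $n_{\mathrm{bin}},n_{\mathrm{spec}},n_{\mathrm{mat}}\ge 1$ be integers, $c>0$ a real number, and $0<E_1<E_2<\dots<E_{n_{\mathrm{spec}}}<E_{\max}$ real numbers (binding energies and the maximal X-ray energy). Set $E_{n_{\mathrm{spec}}+1}:=E_{\max}$ and define the spectral intervals $I_i=[E_i,E_{i+1})$ for $i=1,\dots,n_{\mathrm{spec}}$. For $b=1,\dots,n_{\mathrm{bin}}$ let $s_b:[0,E_{\max}]\to[0,\infty)$ be the sensitivity functions, which are nonnegative and (Lebesgue) integrable. For $m=1,\dots,n_{\mathrm{mat}}$ let $a_m^{(i)}\in\mathbb{R}$, $i=1,\dots,n_{\mathrm{spec}}$, be the coefficients of the attenuation spectrum of material $m$, i.e. $\mu_m(E)=E^{-c}\sum_{i=1}^{n_{\mathrm{spec}}}a_m^{(i)}\mathbf{1}_{I_i}(E)$.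 Let $A\in\mathbb{R}^{n_{\mathrm{spec}}\times n_{\mathrm{mat}}}$ be the matrix whose entry in row $i$ and column $m$ is $a_m^{(i)}$, and for $k\in\{1,\dots,n_{\mathrm{spec}}\}$ let $A^{(k)}\in\mathbb{R}^{(n_{\mathrm{spec}}-k+1)\times n_{\mathrm{mat}}}$ be the matrix consisting of the rows $k,k+1,\dots,n_{\mathrm{spec}}$ of $A$. The bin-sinogram function $\Phi=(\Phi_1,\dots,\Phi_{n_{\mathrm{bin}}})$ is the map $\mathbb{R}^{n_{\mathrm{mat}}}\to\mathbb{R}^{n_{\mathrm{bin}}}$ given by $$\Phi_b(z)=\sum_{i=1}^{n_{\mathrm{spec}}}\int_{I_i}s_b(E)\exp\Big(-E^{-c}\sum_{m=1}^{n_{\mathrm{mat}}}a_m^{(i)}z_m\Big)\,\mathrm{d}E,\qquad b=1,\dots,n_{\mathrm{bin}}.$$ $\operatorname{Im}(\Phi)$ denotes the image (range) of $\Phi$. *)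

theory Defs
  imports "HOL-Analysis.Analysis" "Jordan_Normal_Form.Matrix_Kernel"
begin

unbundle no vec_syntax

text \<open>
  The families \<open>E\<close>, \<open>s\<close>, \<open>a\<close> carry the indices of the text, starting at 1; vectors and matrices
  start at 0, hence the index shifts below. The family \<open>E\<close> includes the final edge
  \<open>E (n_spec + 1) = E_max\<close>, and \<open>a m i\<close> is the coefficient of material \<open>m\<close> on the \<open>i\<close>-th
  spectral interval.
\<close>

definition spectral_interval :: "(nat \<Rightarrow> real) \<Rightarrow> nat \<Rightarrow> real set" where
  "spectral_interval E i = {E i ..< E (i + 1)}"

definition attenuation_matrix :: "nat \<Rightarrow> nat \<Rightarrow> (nat \<Rightarrow> nat \<Rightarrow> real) \<Rightarrow> real mat" where
  "attenuation_matrix n_spec n_mat a = mat n_spec n_mat (\<lambda>(i, m). a (m + 1) (i + 1))"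

text \<open>The rows \<open>k, \<dots>, dim_row A\<close> of \<open>A\<close>, with rows counted from 1.\<close>

definition rows_from :: "real mat \<Rightarrow> nat \<Rightarrow> real mat" where
  "rows_from A k =
     mat (dim_row A - k + 1) (dim_col A) (\<lambda>(i, m). A $$ (k - 1 + i, m))"

definition bin_sinogram ::
    "nat \<Rightarrow> nat \<Rightarrow> nat \<Rightarrow> real \<Rightarrow> (nat \<Rightarrow> real) \<Rightarrow> (nat \<Rightarrow> real \<Rightarrow> real) \<Rightarrow>
     (nat \<Rightarrow> nat \<Rightarrow> real) \<Rightarrow> real vec \<Rightarrow> real vec" where
  "bin_sinogram n_bin n_spec n_mat c E s a z =
     vec n_bin (\<lambda>b. \<Sum>i = 1..n_spec.
       LINT e : spectral_interval E i | lebesgue.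
         s (b + 1) e * exp (- (e powr (- c)) * (\<Sum>m = 1..n_mat. a m i * z $ (m - 1))))"

end

theory Submission
  imports Defs
begin

text \<open>
  The spectral intervals are peeled off from the top. The vector \<open>z\<close> enters \<open>\<Phi>\<close> only through the
  line integrals \<open>t\<^sub>i = \<Sum>\<^sub>m a\<^sub>m\<^sup>i z\<^sub>m\<close>, one for each spectral interval \<open>I\<^sub>i\<close>, and bin \<open>b\<close> receives from
  \<open>I\<^sub>i\<close> the contribution \<open>f\<^sub>b\<^sub>,\<^sub>i(t\<^sub>i) = \<integral>\<^bsub>I\<^sub>i\<^esub> s\<^sub>b(e) exp(-e\<^bsup>-c\<^esup> t\<^sub>i) de\<close>. If \<open>s\<^sub>b\<close> has zero mass on \<open>I\<^sub>i\<close>, then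
  \<open>f\<^sub>b\<^sub>,\<^sub>i\<close> vanishes identically; otherwise it is strictly decreasing, hence injective
  (\<open>exp_attenuated_integral_eq_0\<close>, \<open>exp_attenuated_integral_inj\<close>).

  Let \<open>\<Phi> z = \<Phi> z'\<close>. The bin \<open>b\<^sub>i\<close> does not see the intervals below \<open>I\<^sub>i\<close>, so its measurement is
  \<open>\<Sum>\<^bsub>j \<ge> i\<^esub> f(t\<^sub>j)\<close>. This is a triangular system: once \<open>t\<^sub>j = t'\<^sub>j\<close> is known for all \<open>j > i\<close>, the terms
  with \<open>j > i\<close> cancel, and injectivity of the remaining term gives \<open>t\<^sub>i = t'\<^sub>i\<close>
  (\<open>triangular_system_unique\<close>). Descending to \<open>i = k\<close> gives \<open>A\<^sup>k z = A\<^sup>k z'\<close>, where \<open>A\<^sup>k\<close> consists of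
  the rows of \<open>A\<close> from \<open>k\<close> on, and the trivial kernel of \<open>A\<^sup>k\<close> yields \<open>z = z'\<close>.
\<close>

lemma set_integral_nonneg_eq_0_iff_AE:
  fixes f :: "'a \<Rightarrow> real"
  assumes "set_integrable M S f" and "\<And>x. x \<in> S \<Longrightarrow> f x \<ge> 0"
  shows "(LINT x : S | M. f x) = 0 \<longleftrightarrow> (AE x\<in>S in M. f x = 0)"
proof -
  have "(LINT x : S | M. f x) = 0 \<longleftrightarrow> (AE x in M. indicator S x *\<^sub>R f x = 0)"
    unfolding set_lebesgue_integral_def
    using assms by (intro integral_nonneg_eq_0_iff_AE)
      (auto simp: set_integrable_def indicator_def)
  also have "\<dots> \<longleftrightarrow> (AE x\<in>S in M. f x = 0)"
    by (auto simp: indicator_def)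
  finally show ?thesis .
qed

text \<open>
  Both integrals vanish exactly if \<open>s\<close> vanishes almost everywhere on \<open>S\<close>. This turns hypotheses
  about the mass of \<open>s\<close> into statements about integrals with exponential weights.
\<close>

lemma set_integral_positive_weight_eq_0_iff:
  fixes s h :: "'a \<Rightarrow> real"
  assumes "set_integrable M S s" and "set_integrable M S (\<lambda>x. s x * h x)"
    and "\<And>x. x \<in> S \<Longrightarrow> s x \<ge> 0" and "\<And>x. x \<in> S \<Longrightarrow> h x > 0"
  shows "(LINT x : S | M. s x * h x) = 0 \<longleftrightarrow> (LINT x : S | M. s x) = 0"
proof -
  have "(LINT x : S | M. s x * h x) = 0 \<longleftrightarrow> (AE x\<in>S in M. s x * h x = 0)"
    using assms by (intro set_integral_nonneg_eq_0_iff_AE) (auto intro: mult_nonneg_nonneg less_imp_le)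
  also have "\<dots> \<longleftrightarrow> (AE x\<in>S in M. s x = 0)"
    using assms(4) by (intro AE_cong) force
  also have "\<dots> \<longleftrightarrow> (LINT x : S | M. s x) = 0"
    using assms by (intro set_integral_nonneg_eq_0_iff_AE[symmetric]) auto
  finally show ?thesis .
qed

text \<open>
  The sign of \<open>t\<close> is arbitrary, so the exponential can exceed 1; the upper bound on \<open>w\<close> keeps it below
  \<open>exp (B * \<bar>t\<bar>)\<close>, and a multiple of \<open>s\<close> dominates.
\<close>

lemma set_integrable_exp_attenuated:
  fixes s w :: "'a \<Rightarrow> real"
  assumes "S \<in> sets M" and "set_integrable M S s" and "w \<in> borel_measurable M"
    and "\<And>x. x \<in> S \<Longrightarrow> 0 < w x" and "\<And>x. x \<in> S \<Longrightarrow> w x \<le> B"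
  shows "set_integrable M S (\<lambda>x. s x * exp (- w x * t))"
proof -
  have "integrable M (\<lambda>x. exp (B * \<bar>t\<bar>) * (indicator S x *\<^sub>R s x))"
    using assms(2) by (auto simp: set_integrable_def)
  moreover have "(\<lambda>x. indicator S x *\<^sub>R (s x * exp (- w x * t))) \<in> borel_measurable M"
  proof -
    have "(\<lambda>x. (indicator S x *\<^sub>R s x) * exp (- w x * t)) \<in> borel_measurable M"
      using assms(2,3) unfolding set_integrable_def
      by (intro borel_measurable_times) (auto dest: borel_measurable_integrable)
    then show ?thesis by (simp add: mult.assoc)
  qed
  moreover have "norm (indicator S x *\<^sub>R (s x * exp (- w x * t)))
      \<le> norm (exp (B * \<bar>t\<bar>) * (indicator S x *\<^sub>R s x))" for x
  proof (cases "x \<in> S")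
    case True
    have "- w x * t \<le> w x * \<bar>t\<bar>"
      using assms(4)[OF True] by (simp add: abs_if mult_nonneg_nonneg less_imp_le)
    also have "\<dots> \<le> B * \<bar>t\<bar>"
      using assms(5)[OF True] by (intro mult_right_mono) auto
    finally have "exp (- w x * t) \<le> exp (B * \<bar>t\<bar>)" by simp
    then show ?thesis
      using True by (simp add: abs_mult mult.commute mult_left_mono)
  qed simp
  ultimately show ?thesis
    unfolding set_integrable_def by (rule Bochner_Integration.integrable_bound[OF _ _ AE_I2])
qed

lemma exp_attenuated_integral_eq_0:
  fixes s w :: "'a \<Rightarrow> real"
  assumes "S \<in> sets M" and "set_integrable M S s" and "w \<in> borel_measurable M"
    and "\<And>x. x \<in> S \<Longrightarrow> 0 < w x" and "\<And>x. x \<in> S \<Longrightarrow> w x \<le> B"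
    and "\<And>x. x \<in> S \<Longrightarrow> s x \<ge> 0" and "(LINT x : S | M. s x) = 0"
  shows "(LINT x : S | M. s x * exp (- w x * t)) = 0"
  using set_integral_positive_weight_eq_0_iff
    [OF assms(2) set_integrable_exp_attenuated[OF assms(1-5)] assms(6)] assms(7) by simp

text \<open>
  For \<open>t < t'\<close> the difference of the two integrals has the density \<open>s\<close> times the weight
  \<open>exp (- w t) - exp (- w t')\<close>, which is strictly positive because \<open>w\<close> is. If the difference were
  zero, then \<open>s\<close> would have no mass on \<open>S\<close>.
\<close>

lemma exp_attenuated_integral_inj:
  fixes s w :: "'a \<Rightarrow> real"
  assumes "S \<in> sets M" and "set_integrable M S s" and "w \<in> borel_measurable M"
    and "\<And>x. x \<in> S \<Longrightarrow> 0 < w x" and "\<And>x. x \<in> S \<Longrightarrow> w x \<le> B"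
    and "\<And>x. x \<in> S \<Longrightarrow> s x \<ge> 0" and "(LINT x : S | M. s x) \<noteq> 0"
  shows "inj (\<lambda>t. LINT x : S | M. s x * exp (- w x * t))"
proof -
  let ?f = "\<lambda>t. LINT x : S | M. s x * exp (- w x * t)"
  have "?f t \<noteq> ?f t'" if "t < t'" for t t'
  proof
    assume eq: "?f t = ?f t'"
    have int: "set_integrable M S (\<lambda>x. s x * exp (- w x * t))" for t
      by (rule set_integrable_exp_attenuated[OF assms(1-5)])
    have *: "(\<lambda>x. s x * (exp (- w x * t) - exp (- w x * t')))
        = (\<lambda>x. s x * exp (- w x * t) - s x * exp (- w x * t'))"
      by (simp add: right_diff_distrib)
    have "(LINT x : S | M. s x * (exp (- w x * t) - exp (- w x * t'))) = 0"
      unfolding * using set_integral_diff(2)[OF int int, of t t'] eq by simp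
    moreover have "set_integrable M S (\<lambda>x. s x * (exp (- w x * t) - exp (- w x * t')))"
      unfolding * by (rule set_integral_diff(1)[OF int int])
    moreover have "exp (- w x * t) - exp (- w x * t') > 0" if "x \<in> S" for x
      using assms(4)[OF that] \<open>t < t'\<close> by simp
    ultimately have "(LINT x : S | M. s x) = 0"
      using set_integral_positive_weight_eq_0_iff
        [OF assms(2), of "\<lambda>x. exp (- w x * t) - exp (- w x * t')"] assms(6) by simp
    with assms(7) show False by simp
  qed
  then show ?thesis by (intro linorder_injI) auto
qed

text \<open>
  Back substitution for a nonlinear triangular system: \<open>b i\<close> selects the equation that determines
  the \<open>i\<close>-th unknown from the later ones. The unknowns below \<open>k\<close> stay undetermined, since the
  selected equations do not depend on them.
\<close>

lemma triangular_system_unique: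
  fixes f :: "'b \<Rightarrow> nat \<Rightarrow> 'a \<Rightarrow> real"
  assumes "k \<ge> 1"
    and zero: "\<And>i j t. i \<in> {k..n} \<Longrightarrow> j \<in> {1..n} \<Longrightarrow> j < i \<Longrightarrow> f (b i) j t = 0"
    and inj: "\<And>i. i \<in> {k..n} \<Longrightarrow> inj (f (b i) i)"
    and eq: "\<And>i. i \<in> {k..n} \<Longrightarrow> (\<Sum>j = 1..n. f (b i) j (t j)) = (\<Sum>j = 1..n. f (b i) j (t' j))"
    and "i \<in> {k..n}"
  shows "t i = t' i"
  using \<open>i \<in> {k..n}\<close>
proof (induction "n - i" arbitrary: i rule: less_induct)
  case less
  have mem: "i \<in> {1..n}" using less.prems \<open>k \<ge> 1\<close> by auto
  have "f (b i) j (t j) = f (b i) j (t' j)" if "j \<in> {1..n} - {i}" for j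
  proof (cases "j < i")
    case True
    then show ?thesis using zero[OF less.prems] that by simp
  next
    case False
    then have "t j = t' j" using that less.prems by (intro less.hyps) auto
    then show ?thesis by simp
  qed
  then have "(\<Sum>j\<in>{1..n} - {i}. f (b i) j (t j)) = (\<Sum>j\<in>{1..n} - {i}. f (b i) j (t' j))"
    by (intro sum.cong) auto
  then have "f (b i) i (t i) = f (b i) i (t' i)"
    using eq[OF less.prems] mem by (simp add: sum.remove[of _ i])
  then show ?case using inj[OF less.prems] by (simp add: inj_eq)
qed

lemma rows_from_attenuation_matrix_mult_eq_0:
  assumes "k \<in> {1..n_spec}" and "v \<in> carrier_vec n_mat"
    and "\<And>i. i \<in> {k..n_spec} \<Longrightarrow> (\<Sum>m = 1..n_mat. a m i * v $ (m - 1)) = 0"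
  shows "v \<in> mat_kernel (rows_from (attenuation_matrix n_spec n_mat a) k)"
proof -
  let ?R = "rows_from (attenuation_matrix n_spec n_mat a) k"
  have "(?R *\<^sub>v v) $ r = 0" if r: "r < n_spec - k + 1" for r
  proof -
    have "(?R *\<^sub>v v) $ r = (\<Sum>m = 0..<n_mat. a (Suc m) (k + r) * v $ m)"
      using assms(1,2) r
      by (auto simp: rows_from_def attenuation_matrix_def scalar_prod_def intro!: sum.cong)
    also have "\<dots> = (\<Sum>m = 1..n_mat. a m (k + r) * v $ (m - 1))"
      by (rule sum.reindex_bij_witness[of _ "\<lambda>m. m - 1" Suc]) auto
    also have "\<dots> = 0" using r assms(1) by (intro assms(3)) auto
    finally show ?thesis .
  qed
  then show ?thesis
    using assms(2) by (auto simp: mat_kernel_def rows_from_def attenuation_matrix_def)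
qed

theorem theorem3p7:
  fixes n_bin n_spec n_mat :: nat
    and c E_max :: real
    and E :: "nat \<Rightarrow> real"
    and s :: "nat \<Rightarrow> real \<Rightarrow> real"
    and a :: "nat \<Rightarrow> nat \<Rightarrow> real"
  defines "A \<equiv> attenuation_matrix n_spec n_mat a"
    and "\<Phi> \<equiv> bin_sinogram n_bin n_spec n_mat c E s a"
  assumes "n_bin \<ge> 1" and "n_spec \<ge> 1" and "n_mat \<ge> 1"
    and "c > 0"
    and "0 < E 1" and "strict_mono_on {1..n_spec} E"
    and "E n_spec < E_max" and "E (n_spec + 1) = E_max"
    and "\<And>b e. b \<in> {1..n_bin} \<Longrightarrow> e \<in> {0..E_max} \<Longrightarrow> s b e \<ge> 0"
    and "\<And>b. b \<in> {1..n_bin} \<Longrightarrow> set_integrable lebesgue {0..E_max} (s b)"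
    and "\<exists>k\<in>{1..n_spec}.
           mat_kernel (rows_from A k) = {0\<^sub>v n_mat} \<and>
           (\<forall>i\<in>{k..n_spec}. \<exists>b\<in>{1..n_bin}.
              (\<forall>j\<in>{1..n_spec}. j \<ge> i \<longrightarrow>
                 (LINT e : spectral_interval E j | lebesgue. s b e) \<noteq> 0) \<and>
              (\<forall>j\<in>{1..n_spec}. j < i \<longrightarrow>
                 (LINT e : spectral_interval E j | lebesgue. s b e) = 0))"
  shows "\<forall>y \<in> \<Phi> ` carrier_vec n_mat. \<exists>!z. z \<in> carrier_vec n_mat \<and> \<Phi> z = y"
proof -
  define t where "t z i = (\<Sum>m = 1..n_mat. a m i * z $ (m - 1))" for z :: "real vec" and i
  define f where "f b i u = (LINT e : spectral_interval E i | lebesgue.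
      s b e * exp (- (e powr (- c)) * u))" for b i u
  obtain k where k: "k \<in> {1..n_spec}"
    and ker: "mat_kernel (rows_from A k) = {0\<^sub>v n_mat}"
    and "\<forall>i\<in>{k..n_spec}. \<exists>b\<in>{1..n_bin}.
              (\<forall>j\<in>{1..n_spec}. j \<ge> i \<longrightarrow>
                 (LINT e : spectral_interval E j | lebesgue. s b e) \<noteq> 0) \<and>
              (\<forall>j\<in>{1..n_spec}. j < i \<longrightarrow>
                 (LINT e : spectral_interval E j | lebesgue. s b e) = 0)"
    using assms(13) by (elim bexE conjE)
  then have "\<forall>i\<in>{k..n_spec}. \<exists>b. b \<in> {1..n_bin} \<and>
              (\<forall>j\<in>{1..n_spec}. j \<ge> i \<longrightarrow>
                 (LINT e : spectral_interval E j | lebesgue. s b e) \<noteq> 0) \<and>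
              (\<forall>j\<in>{1..n_spec}. j < i \<longrightarrow>
                 (LINT e : spectral_interval E j | lebesgue. s b e) = 0)"
    by (simp only: Bex_def)
  from bchoice[OF this] obtain b where "\<forall>i\<in>{k..n_spec}. b i \<in> {1..n_bin} \<and>
              (\<forall>j\<in>{1..n_spec}. j \<ge> i \<longrightarrow>
                 (LINT e : spectral_interval E j | lebesgue. s (b i) e) \<noteq> 0) \<and>
              (\<forall>j\<in>{1..n_spec}. j < i \<longrightarrow>
                 (LINT e : spectral_interval E j | lebesgue. s (b i) e) = 0)"
    by (rule exE)
  then have b: "\<And>i. i \<in> {k..n_spec} \<Longrightarrow> b i \<in> {1..n_bin}"
    and mass: "\<And>i j. i \<in> {k..n_spec} \<Longrightarrow> j \<in> {1..n_spec} \<Longrightarrow> j \<ge> i \<Longrightarrow>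
                 (LINT e : spectral_interval E j | lebesgue. s (b i) e) \<noteq> 0"
    and no_mass: "\<And>i j. i \<in> {k..n_spec} \<Longrightarrow> j \<in> {1..n_spec} \<Longrightarrow> j < i \<Longrightarrow>
                 (LINT e : spectral_interval E j | lebesgue. s (b i) e) = 0"
    by blast+
  have E_pos: "0 < E j" if "j \<in> {1..n_spec}" for j
    using strict_mono_onD[OF \<open>strict_mono_on {1..n_spec} E\<close>, of 1 j] that \<open>0 < E 1\<close>
    by (cases "j = 1") auto
  have E_le: "E (j + 1) \<le> E_max" if j: "j \<in> {1..n_spec}" for j
  proof (cases "j + 1 \<le> n_spec")
    case True
    then have "E (j + 1) \<le> E n_spec"
      using strict_mono_onD[OF \<open>strict_mono_on {1..n_spec} E\<close>, of "j + 1" n_spec] j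
      by (cases "j + 1 = n_spec") auto
    then show ?thesis using \<open>E n_spec < E_max\<close> by simp
  next
    case False
    then have "j = n_spec" using j by simp
    then show ?thesis using \<open>E (n_spec + 1) = E_max\<close> by simp
  qed
  have sub: "spectral_interval E j \<subseteq> {0..E_max}" if "j \<in> {1..n_spec}" for j
    using E_pos[OF that] E_le[OF that] by (auto simp: spectral_interval_def)
  have meas: "spectral_interval E j \<in> sets lebesgue" for j
    by (simp add: spectral_interval_def)
  have s_int: "set_integrable lebesgue (spectral_interval E j) (s b')"
    if "j \<in> {1..n_spec}" "b' \<in> {1..n_bin}" for j b'
    using set_integrable_subset[OF assms(12)[OF that(2)] meas sub[OF that(1)]] .
  have s_nonneg: "s b' e \<ge> 0"
    if "j \<in> {1..n_spec}" "b' \<in> {1..n_bin}" "e \<in> spectral_interval E j" for j b' e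
    using assms(11) that sub by blast
  have w_meas: "(\<lambda>e. e powr (- c)) \<in> borel_measurable lebesgue"
    by (intro measurable_completion) simp
  have w_pos: "0 < e powr (- c)" if "j \<in> {1..n_spec}" "e \<in> spectral_interval E j" for j e
    using E_pos[OF that(1)] that(2) by (auto simp: spectral_interval_def)
  \<comment> \<open>The weight blows up at 0; since \<open>E 1 > 0\<close>, it is bounded on every spectral interval.\<close>
  have w_le: "e powr (- c) \<le> E j powr (- c)"
    if "j \<in> {1..n_spec}" "e \<in> spectral_interval E j" for j e
    using E_pos[OF that(1)] that(2) \<open>c > 0\<close>
    by (intro powr_mono2') (auto simp: spectral_interval_def)
  have f_zero: "f (b i) j u = 0" if "i \<in> {k..n_spec}" "j \<in> {1..n_spec}" "j < i" for i j u
    unfolding f_def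
    by (rule exp_attenuated_integral_eq_0[OF meas s_int w_meas w_pos w_le s_nonneg no_mass])
      (use that b in auto)
  have f_inj: "inj (f (b i) i)" if i: "i \<in> {k..n_spec}" for i
  proof -
    have i': "i \<in> {1..n_spec}" using i k by auto
    show ?thesis
      unfolding f_def
      by (rule exp_attenuated_integral_inj[OF meas s_int[OF i' b[OF i]] w_meas w_pos[OF i']
            w_le[OF i'] s_nonneg[OF i' b[OF i]] mass[OF i i']]) auto
  qed
  have \<Phi>_index: "\<Phi> z $ (b' - 1) = (\<Sum>i = 1..n_spec. f b' i (t z i))"
    if "b' \<in> {1..n_bin}" for z b'
  proof -
    have "b' - 1 < n_bin" and "b' - 1 + 1 = b'" using that by auto
    then show ?thesis by (simp only: \<Phi>_def bin_sinogram_def f_def t_def index_vec)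
  qed
  have "z = z'" if z: "z \<in> carrier_vec n_mat" "z' \<in> carrier_vec n_mat" and eq: "\<Phi> z = \<Phi> z'" for z z'
  proof -
    have sums_eq: "(\<Sum>j = 1..n_spec. f (b i) j (t z j)) = (\<Sum>j = 1..n_spec. f (b i) j (t z' j))"
      if "i \<in> {k..n_spec}" for i
      unfolding \<Phi>_index[OF b[OF that], symmetric] eq ..
    have t_eq: "t z i = t z' i" if "i \<in> {k..n_spec}" for i
      by (rule triangular_system_unique[where f = f and b = b, OF _ f_zero f_inj sums_eq that]) (use k in auto)
    have t_diff: "(\<Sum>m = 1..n_mat. a m i * (z - z') $ (m - 1)) = t z i - t z' i" for i
      unfolding t_def sum_subtractf[symmetric]
      using z by (intro sum.cong) (auto simp: right_diff_distrib)
    have "z - z' \<in> mat_kernel (rows_from A k)"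
      unfolding A_def
    proof (rule rows_from_attenuation_matrix_mult_eq_0[OF k])
      show "z - z' \<in> carrier_vec n_mat" using z by simp
      show "(\<Sum>m = 1..n_mat. a m i * (z - z') $ (m - 1)) = 0" if "i \<in> {k..n_spec}" for i
        unfolding t_diff t_eq[OF that] by simp
    qed
    then have diff: "z - z' = 0\<^sub>v n_mat" using ker by simp
    show ?thesis
    proof (rule eq_vecI)
      fix m assume m: "m < dim_vec z'"
      have "(z - z') $ m = 0\<^sub>v n_mat $ m" by (simp only: diff)
      then show "z $ m = z' $ m" using m z by simp
    qed (use z in simp)
  qed
  then show ?thesis by blast
qed

end
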